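(* Let $G=H\ast K$ be the free product of the non-trivial groups $H$ and $K$ with $|H|>2$. Then $P(G)=\{1\}$.
   Context: For a group $G$, the pseudocentre is $P(G)=\bigcap_{x\in G}C_G(x)^G$, where $C_G(x)$ is the centralizer of $x$ in $G$ and, for a subgroup $H\leq G$, $H^G$ is the normal closure of $H$ in $G$. *)

theory Defs
  imports "HOL-Algebra.Algebra"
begin

section \<open>Pseudocentre\<close>

definition centralizer :: "('a, 'm) monoid_scheme \<Rightarrow> 'a \<Rightarrow> 'a set" where
  "centralizer G x = {g \<in> carrier G. g \<otimes>\<^bsub>G\<^esub> x = x \<otimes>\<^bsub>G\<^esub> g}"

definition normal_closure :: "('a, 'm) monoid_scheme \<Rightarrow> 'a set \<Rightarrow> 'a set" where
  "normal_closure G S = \<Inter>{N. N \<lhd> G \<and> S \<subseteq> N}"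

definition pseudocentre :: "('a, 'm) monoid_scheme \<Rightarrow> 'a set" where
  "pseudocentre G = (\<Inter>x\<in>carrier G. normal_closure G (centralizer G x))"

section \<open>Free products\<close>

text \<open>The elements of the free product of \<open>H\<close> and \<open>K\<close> are classes of words in the disjoint
  union of \<open>H\<close> and \<open>K\<close>, modulo the congruence which deletes identity letters and multiplies
  adjacent letters that come from the same factor. The closure premises on \<open>\<one>\<close> and products
  below hold automatically in groups; they make the relation live on words for arbitrary records.\<close>

abbreviation fp_words :: "('a, 'm) monoid_scheme \<Rightarrow> ('b, 'n) monoid_scheme \<Rightarrow> ('a + 'b) list set" where
  "fp_words H K \<equiv> lists (Sum_Type.Plus (carrier H) (carrier K))"

inductive_set fp_rel ::
    "('a, 'm) monoid_scheme \<Rightarrow> ('b, 'n) monoid_scheme \<Rightarrow> (('a + 'b) list \<times> ('a + 'b) list) set"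
  for H :: "('a, 'm) monoid_scheme" and K :: "('b, 'n) monoid_scheme" where
  refl: "w \<in> fp_words H K \<Longrightarrow> (w, w) \<in> fp_rel H K"
| sym: "(v, w) \<in> fp_rel H K \<Longrightarrow> (w, v) \<in> fp_rel H K"
| trans: "(u, v) \<in> fp_rel H K \<Longrightarrow> (v, w) \<in> fp_rel H K \<Longrightarrow> (u, w) \<in> fp_rel H K"
| one_left: "u \<in> fp_words H K \<Longrightarrow> v \<in> fp_words H K \<Longrightarrow> \<one>\<^bsub>H\<^esub> \<in> carrier H \<Longrightarrow>
    (u @ [Inl \<one>\<^bsub>H\<^esub>] @ v, u @ v) \<in> fp_rel H K"
| one_right: "u \<in> fp_words H K \<Longrightarrow> v \<in> fp_words H K \<Longrightarrow> \<one>\<^bsub>K\<^esub> \<in> carrier K \<Longrightarrow>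
    (u @ [Inr \<one>\<^bsub>K\<^esub>] @ v, u @ v) \<in> fp_rel H K"
| mult_left: "u \<in> fp_words H K \<Longrightarrow> v \<in> fp_words H K \<Longrightarrow> a \<in> carrier H \<Longrightarrow> b \<in> carrier H \<Longrightarrow>
    a \<otimes>\<^bsub>H\<^esub> b \<in> carrier H \<Longrightarrow>
    (u @ [Inl a, Inl b] @ v, u @ [Inl (a \<otimes>\<^bsub>H\<^esub> b)] @ v) \<in> fp_rel H K"
| mult_right: "u \<in> fp_words H K \<Longrightarrow> v \<in> fp_words H K \<Longrightarrow> a \<in> carrier K \<Longrightarrow> b \<in> carrier K \<Longrightarrow>
    a \<otimes>\<^bsub>K\<^esub> b \<in> carrier K \<Longrightarrow>
    (u @ [Inr a, Inr b] @ v, u @ [Inr (a \<otimes>\<^bsub>K\<^esub> b)] @ v) \<in> fp_rel H K"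

definition free_product ::
    "('a, 'm) monoid_scheme \<Rightarrow> ('b, 'n) monoid_scheme \<Rightarrow> ('a + 'b) list set monoid" where
  "free_product H K =
    \<lparr>carrier = fp_words H K // fp_rel H K,
     monoid.mult = (\<lambda>A B. \<Union>u\<in>A. \<Union>v\<in>B. fp_rel H K `` {u @ v}),
     one = fp_rel H K `` {[]}\<rparr>"

lemma Plus_mem_iff [simp]:
  "Inl a \<in> Sum_Type.Plus A B \<longleftrightarrow> a \<in> A" "Inr b \<in> Sum_Type.Plus A B \<longleftrightarrow> b \<in> B"
  by auto

lemma fp_rel_words: "(u, v) \<in> fp_rel H K \<Longrightarrow> u \<in> fp_words H K \<and> v \<in> fp_words H K"
  by (induction rule: fp_rel.induct) auto

lemma equiv_fp_rel: "equiv (fp_words H K) (fp_rel H K)"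
proof (rule equivI)
  show "fp_rel H K \<subseteq> fp_words H K \<times> fp_words H K"
    using fp_rel_words by fast
  show "refl_on (fp_words H K) (fp_rel H K)"
    by (rule refl_onI) (rule fp_rel.refl)
  show "sym (fp_rel H K)"
    by (rule symI) (rule fp_rel.sym)
  show "trans (fp_rel H K)"
    by (rule transI) (rule fp_rel.trans)
qed

lemma fp_rel_context:
  assumes "(u, v) \<in> fp_rel H K" "x \<in> fp_words H K" "y \<in> fp_words H K"
  shows "(x @ u @ y, x @ v @ y) \<in> fp_rel H K"
  using assms
proof (induction rule: fp_rel.induct)
  case (refl w)
  then show ?case by (intro fp_rel.refl) auto
next
  case (sym v w)
  then show ?case by (blast intro: fp_rel.sym)
next
  case (trans u v w)
  then show ?case by (blast intro: fp_rel.trans)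
next
  case (one_left u v)
  then show ?case using fp_rel.one_left[of "x @ u" H K "v @ y"] by auto
next
  case (one_right u v)
  then show ?case using fp_rel.one_right[of "x @ u" H K "v @ y"] by auto
next
  case (mult_left u v a b)
  then show ?case using fp_rel.mult_left[of "x @ u" H K "v @ y" a b] by auto
next
  case (mult_right u v a b)
  then show ?case using fp_rel.mult_right[of "x @ u" H K "v @ y" a b] by auto
qed

lemma fp_rel_append:
  assumes "(u, u') \<in> fp_rel H K" "(v, v') \<in> fp_rel H K"
  shows "(u @ v, u' @ v') \<in> fp_rel H K"
proof -
  have "(u @ v, u' @ v) \<in> fp_rel H K"
    using fp_rel_context[OF assms(1), of "[]" v] fp_rel_words[OF assms(2)] by simp
  moreover have "(u' @ v, u' @ v') \<in> fp_rel H K"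
    using fp_rel_context[OF assms(2), of u' "[]"] fp_rel_words[OF assms(1)] by simp
  ultimately show ?thesis by (rule fp_rel.trans)
qed

lemma free_product_mult_class:
  assumes "u \<in> fp_words H K" "v \<in> fp_words H K"
  shows "fp_rel H K `` {u} \<otimes>\<^bsub>free_product H K\<^esub> fp_rel H K `` {v} = fp_rel H K `` {u @ v}"
proof -
  have eq: "fp_rel H K `` {u' @ v'} = fp_rel H K `` {u @ v}"
    if "u' \<in> fp_rel H K `` {u}" "v' \<in> fp_rel H K `` {v}" for u' v'
  proof -
    from that have "(u @ v, u' @ v') \<in> fp_rel H K"
      by (intro fp_rel_append) auto
    from equiv_class_eq[OF equiv_fp_rel this] show ?thesis by (rule HOL.sym)
  qed
  have ne: "fp_rel H K `` {u} \<noteq> {}" "fp_rel H K `` {v} \<noteq> {}"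
    using fp_rel.refl[OF assms(1)] fp_rel.refl[OF assms(2)] by blast+
  have "fp_rel H K `` {u} \<otimes>\<^bsub>free_product H K\<^esub> fp_rel H K `` {v} =
      (\<Union>u'\<in>fp_rel H K `` {u}. \<Union>v'\<in>fp_rel H K `` {v}. fp_rel H K `` {u' @ v'})"
    by (simp add: free_product_def)
  also have "\<dots> = (\<Union>u'\<in>fp_rel H K `` {u}. \<Union>v'\<in>fp_rel H K `` {v}. fp_rel H K `` {u @ v})"
    by (intro SUP_cong HOL.refl eq)
  also have "\<dots> = fp_rel H K `` {u @ v}"
    using ne by (simp only: UN_constant if_False)
  finally show ?thesis .
qed

lemma free_product_carrierE:
  assumes "x \<in> carrier (free_product H K)"
  obtains w where "w \<in> fp_words H K" "x = fp_rel H K `` {w}"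
proof -
  from assms have "x \<in> fp_words H K // fp_rel H K"
    by (simp add: free_product_def)
  then show ?thesis by (rule quotientE) (rule that)
qed

lemma free_product_class_closed:
  "w \<in> fp_words H K \<Longrightarrow> fp_rel H K `` {w} \<in> carrier (free_product H K)"
  by (simp add: free_product_def quotientI)

lemma fp_rel_inverse_letter:
  assumes "group H" "group K" "c \<in> Sum_Type.Plus (carrier H) (carrier K)"
  shows "\<exists>d \<in> Sum_Type.Plus (carrier H) (carrier K). ([d, c], []) \<in> fp_rel H K"
proof -
  interpret H: group H by fact
  interpret K: group K by fact
  from assms(3) show ?thesis
  proof (rule PlusE)
    fix a assume a: "a \<in> carrier H" "c = Inl a"
    have "([Inl (inv\<^bsub>H\<^esub> a), Inl a], [Inl \<one>\<^bsub>H\<^esub>]) \<in> fp_rel H K"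
      using fp_rel.mult_left[of "[]" H K "[]" "inv\<^bsub>H\<^esub> a" a] a by simp
    moreover have "([Inl \<one>\<^bsub>H\<^esub>], []) \<in> fp_rel H K"
      using fp_rel.one_left[of "[]" H K "[]"] by simp
    ultimately have "([Inl (inv\<^bsub>H\<^esub> a), c], []) \<in> fp_rel H K"
      using a by (metis fp_rel.trans)
    then show ?thesis using a by (meson H.inv_closed InlI)
  next
    fix a assume a: "a \<in> carrier K" "c = Inr a"
    have "([Inr (inv\<^bsub>K\<^esub> a), Inr a], [Inr \<one>\<^bsub>K\<^esub>]) \<in> fp_rel H K"
      using fp_rel.mult_right[of "[]" H K "[]" "inv\<^bsub>K\<^esub> a" a] a by simp
    moreover have "([Inr \<one>\<^bsub>K\<^esub>], []) \<in> fp_rel H K"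
      using fp_rel.one_right[of "[]" H K "[]"] by simp
    ultimately have "([Inr (inv\<^bsub>K\<^esub> a), c], []) \<in> fp_rel H K"
      using a by (metis fp_rel.trans)
    then show ?thesis using a by (meson K.inv_closed InrI)
  qed
qed

lemma fp_rel_inverse_word:
  assumes "group H" "group K" "w \<in> fp_words H K"
  shows "\<exists>v \<in> fp_words H K. (v @ w, []) \<in> fp_rel H K"
  using assms(3)
proof (induction w)
  case Nil
  then show ?case by (auto intro: fp_rel.refl)
next
  case (Cons c w)
  then obtain v where v: "v \<in> fp_words H K" "(v @ w, []) \<in> fp_rel H K" by auto
  from Cons.hyps obtain d where d: "d \<in> Sum_Type.Plus (carrier H) (carrier K)" "([d, c], []) \<in> fp_rel H K"
    using fp_rel_inverse_letter[OF assms(1,2)] by blast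
  have "(v @ [d, c] @ w, v @ [] @ w) \<in> fp_rel H K"
    using fp_rel_context[OF d(2) v(1)] Cons by auto
  then have "((v @ [d]) @ c # w, []) \<in> fp_rel H K"
    using v(2) by (simp, metis fp_rel.trans)
  moreover have "v @ [d] \<in> fp_words H K" using v d by auto
  ultimately show ?case by blast
qed

lemma free_product_group:
  assumes "group H" "group K"
  shows "group (free_product H K)"
proof -
  have one: "\<one>\<^bsub>free_product H K\<^esub> = fp_rel H K `` {[]}"
    by (simp add: free_product_def)
  show ?thesis
  proof (rule groupI)
    fix x y assume "x \<in> carrier (free_product H K)" "y \<in> carrier (free_product H K)"
    then obtain u v where "u \<in> fp_words H K" "x = fp_rel H K `` {u}"
      "v \<in> fp_words H K" "y = fp_rel H K `` {v}" by (metis free_product_carrierE)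
    then show "x \<otimes>\<^bsub>free_product H K\<^esub> y \<in> carrier (free_product H K)"
      using free_product_mult_class[of u H K v] free_product_class_closed[of "u @ v" H K] by auto
  next
    show "\<one>\<^bsub>free_product H K\<^esub> \<in> carrier (free_product H K)"
      unfolding one by (rule free_product_class_closed) simp
  next
    fix x y z assume "x \<in> carrier (free_product H K)" "y \<in> carrier (free_product H K)"
      "z \<in> carrier (free_product H K)"
    then obtain u v w where uvw: "u \<in> fp_words H K" "x = fp_rel H K `` {u}"
      "v \<in> fp_words H K" "y = fp_rel H K `` {v}"
      "w \<in> fp_words H K" "z = fp_rel H K `` {w}" by (metis free_product_carrierE)
    then have "u @ v \<in> fp_words H K" "v @ w \<in> fp_words H K" by auto
    with uvw show "x \<otimes>\<^bsub>free_product H K\<^esub> y \<otimes>\<^bsub>free_product H K\<^esub> z =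
        x \<otimes>\<^bsub>free_product H K\<^esub> (y \<otimes>\<^bsub>free_product H K\<^esub> z)"
      by (simp add: free_product_mult_class)
  next
    fix x assume "x \<in> carrier (free_product H K)"
    then obtain u where u: "u \<in> fp_words H K" "x = fp_rel H K `` {u}"
      by (rule free_product_carrierE)
    then show "\<one>\<^bsub>free_product H K\<^esub> \<otimes>\<^bsub>free_product H K\<^esub> x = x"
      using free_product_mult_class[of "[]" H K u] by (simp add: one)
    obtain v where v: "v \<in> fp_words H K" "(v @ u, []) \<in> fp_rel H K"
      using fp_rel_inverse_word[OF assms u(1)] by blast
    have "fp_rel H K `` {v} \<otimes>\<^bsub>free_product H K\<^esub> x = \<one>\<^bsub>free_product H K\<^esub>"
      using free_product_mult_class[OF v(1) u(1)] equiv_class_eq[OF equiv_fp_rel v(2)]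
      by (simp add: one u(2))
    then show "\<exists>y \<in> carrier (free_product H K).
        y \<otimes>\<^bsub>free_product H K\<^esub> x = \<one>\<^bsub>free_product H K\<^esub>"
      using free_product_class_closed[OF v(1)] by blast
  qed
qed

text \<open>The universal property of the coproduct in the category of groups.\<close>

fun fp_eval :: "('c, 'l) monoid_scheme \<Rightarrow> ('a \<Rightarrow> 'c) \<Rightarrow> ('b \<Rightarrow> 'c) \<Rightarrow> ('a + 'b) list \<Rightarrow> 'c" where
  "fp_eval L f g [] = \<one>\<^bsub>L\<^esub>"
| "fp_eval L f g (Inl a # w) = f a \<otimes>\<^bsub>L\<^esub> fp_eval L f g w"
| "fp_eval L f g (Inr b # w) = g b \<otimes>\<^bsub>L\<^esub> fp_eval L f g w"

context
  fixes H :: "('a, 'm) monoid_scheme" and K :: "('b, 'n) monoid_scheme"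
    and L :: "('c, 'l) monoid_scheme" and f :: "'a \<Rightarrow> 'c" and g :: "'b \<Rightarrow> 'c"
  assumes gps: "group H" "group K" "group L" and f: "f \<in> hom H L" and g: "g \<in> hom K L"
begin

interpretation H: group H by (rule gps)
interpretation K: group K by (rule gps)
interpretation L: group L by (rule gps)

lemma fp_eval_closed: "w \<in> fp_words H K \<Longrightarrow> fp_eval L f g w \<in> carrier L"
proof (induction w)
  case (Cons c w)
  then show ?case
    by (cases c) (auto intro: hom_in_carrier[OF f] hom_in_carrier[OF g])
qed simp

lemma fp_eval_append:
  "v \<in> fp_words H K \<Longrightarrow> w \<in> fp_words H K \<Longrightarrow>
    fp_eval L f g (v @ w) = fp_eval L f g v \<otimes>\<^bsub>L\<^esub> fp_eval L f g w"
proof (induction v)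
  case Nil
  then show ?case using fp_eval_closed by simp
next
  case (Cons c v)
  then have v: "v \<in> fp_words H K" and c: "c \<in> Sum_Type.Plus (carrier H) (carrier K)" by auto
  note cl = fp_eval_closed[OF v] fp_eval_closed[OF Cons.prems(2)]
  from c show ?case
    by (rule PlusE) (use Cons.IH[OF v Cons.prems(2)] cl in
      \<open>auto simp: L.m_assoc hom_in_carrier[OF f] hom_in_carrier[OF g]\<close>)
qed

lemma fp_eval_rel: "(v, w) \<in> fp_rel H K \<Longrightarrow> fp_eval L f g v = fp_eval L f g w"
proof (induction rule: fp_rel.induct)
  case (one_left u v)
  then show ?case
    using fp_eval_append[of u "[Inl \<one>\<^bsub>H\<^esub>] @ v"] fp_eval_append[of u v] fp_eval_closed[of v]
    by (auto simp: hom_one[OF f gps(1,3)])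
next
  case (one_right u v)
  then show ?case
    using fp_eval_append[of u "[Inr \<one>\<^bsub>K\<^esub>] @ v"] fp_eval_append[of u v] fp_eval_closed[of v]
    by (auto simp: hom_one[OF g gps(2,3)])
next
  case (mult_left u v a b)
  then show ?case
    using fp_eval_append[of u "[Inl a, Inl b] @ v"] fp_eval_append[of u "[Inl (a \<otimes>\<^bsub>H\<^esub> b)] @ v"]
      fp_eval_closed[of v]
    by (auto simp: L.m_assoc hom_mult[OF f] hom_in_carrier[OF f])
next
  case (mult_right u v a b)
  then show ?case
    using fp_eval_append[of u "[Inr a, Inr b] @ v"] fp_eval_append[of u "[Inr (a \<otimes>\<^bsub>K\<^esub> b)] @ v"]
      fp_eval_closed[of v]
    by (auto simp: L.m_assoc hom_mult[OF g] hom_in_carrier[OF g])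
qed auto

lemma free_product_universal:
  "\<exists>h \<in> hom (free_product H K) L.
    (\<forall>a \<in> carrier H. h (fp_rel H K `` {[Inl a]}) = f a) \<and>
    (\<forall>b \<in> carrier K. h (fp_rel H K `` {[Inr b]}) = g b)"
proof -
  define h where "h A = fp_eval L f g (SOME w. w \<in> A)" for A
  have h: "h (fp_rel H K `` {w}) = fp_eval L f g w" if "w \<in> fp_words H K" for w
  proof -
    have "w \<in> fp_rel H K `` {w}"
      using fp_rel.refl[OF that] by simp
    then have "(SOME v. v \<in> fp_rel H K `` {w}) \<in> fp_rel H K `` {w}"
      by (rule someI)
    then have "(w, SOME v. v \<in> fp_rel H K `` {w}) \<in> fp_rel H K"
      by blast
    from fp_eval_rel[OF this] show ?thesis
      unfolding h_def by (rule HOL.sym)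
  qed
  have "h \<in> hom (free_product H K) L"
  proof (rule homI)
    fix x assume "x \<in> carrier (free_product H K)"
    then show "h x \<in> carrier L"
      by (metis free_product_carrierE h fp_eval_closed)
  next
    fix x y assume "x \<in> carrier (free_product H K)" "y \<in> carrier (free_product H K)"
    then obtain u v where uv: "u \<in> fp_words H K" "x = fp_rel H K `` {u}"
      "v \<in> fp_words H K" "y = fp_rel H K `` {v}" by (metis free_product_carrierE)
    moreover have "u @ v \<in> fp_words H K" using uv by auto
    ultimately show "h (x \<otimes>\<^bsub>free_product H K\<^esub> y) = h x \<otimes>\<^bsub>L\<^esub> h y"
      by (simp add: free_product_mult_class h fp_eval_append)
  qed
  moreover have "h (fp_rel H K `` {[Inl a]}) = f a" if "a \<in> carrier H" for a
    using that h[of "[Inl a]"] hom_in_carrier[OF f] by auto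
  moreover have "h (fp_rel H K `` {[Inr b]}) = g b" if "b \<in> carrier K" for b
    using that h[of "[Inr b]"] hom_in_carrier[OF g] by auto
  ultimately show ?thesis by (intro bexI[of _ h] conjI ballI)
qed

lemma free_product_universal_unique:
  assumes h: "h \<in> hom (free_product H K) L" "h' \<in> hom (free_product H K) L"
    and l: "\<And>a. a \<in> carrier H \<Longrightarrow> h (fp_rel H K `` {[Inl a]}) = h' (fp_rel H K `` {[Inl a]})"
    and r: "\<And>b. b \<in> carrier K \<Longrightarrow> h (fp_rel H K `` {[Inr b]}) = h' (fp_rel H K `` {[Inr b]})"
    and x: "x \<in> carrier (free_product H K)"
  shows "h x = h' x"
proof -
  have "h (fp_rel H K `` {w}) = h' (fp_rel H K `` {w})" if "w \<in> fp_words H K" for w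
    using that
  proof (induction w)
    case Nil
    have "fp_rel H K `` {[]} = \<one>\<^bsub>free_product H K\<^esub>" by (simp add: free_product_def)
    then show ?case
      using hom_one[OF h(1) free_product_group[OF gps(1,2)] gps(3)]
        hom_one[OF h(2) free_product_group[OF gps(1,2)] gps(3)] by simp
  next
    case (Cons c w)
    then have w: "w \<in> fp_words H K" and c: "c \<in> Sum_Type.Plus (carrier H) (carrier K)"
      and cw: "[c] \<in> fp_words H K" by auto
    have eq: "fp_rel H K `` {c # w} =
        fp_rel H K `` {[c]} \<otimes>\<^bsub>free_product H K\<^esub> fp_rel H K `` {w}"
      using free_product_mult_class[OF cw w] by simp
    have "h (fp_rel H K `` {[c]}) = h' (fp_rel H K `` {[c]})"
      using c l r by auto
    then show ?case
      unfolding eq hom_mult[OF h(1) free_product_class_closed[OF cw] free_product_class_closed[OF w]]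
        hom_mult[OF h(2) free_product_class_closed[OF cw] free_product_class_closed[OF w]]
      using Cons.IH w by simp
  qed
  then show ?thesis using x by (metis free_product_carrierE)
qed

end

lemma free_product_incl_left_hom:
  assumes "group H" "group K"
  shows "(\<lambda>a. fp_rel H K `` {[Inl a]}) \<in> hom H (free_product H K)"
proof -
  interpret H: group H by fact
  show ?thesis
  proof (rule homI)
    fix a b assume ab: "a \<in> carrier H" "b \<in> carrier H"
    then have "([Inl a, Inl b], [Inl (a \<otimes>\<^bsub>H\<^esub> b)]) \<in> fp_rel H K"
      using fp_rel.mult_left[of "[]" H K "[]" a b] by simp
    then show "fp_rel H K `` {[Inl (a \<otimes>\<^bsub>H\<^esub> b)]} =
        fp_rel H K `` {[Inl a]} \<otimes>\<^bsub>free_product H K\<^esub> fp_rel H K `` {[Inl b]}"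
      using ab free_product_mult_class[of "[Inl a]" H K "[Inl b]"]
        equiv_class_eq[OF equiv_fp_rel[of H K], of "[Inl a, Inl b]" "[Inl (a \<otimes>\<^bsub>H\<^esub> b)]"] by simp
  qed (auto intro!: free_product_class_closed)
qed

lemma free_product_incl_right_hom:
  assumes "group H" "group K"
  shows "(\<lambda>b. fp_rel H K `` {[Inr b]}) \<in> hom K (free_product H K)"
proof -
  interpret K: group K by fact
  show ?thesis
  proof (rule homI)
    fix a b assume ab: "a \<in> carrier K" "b \<in> carrier K"
    then have "([Inr a, Inr b], [Inr (a \<otimes>\<^bsub>K\<^esub> b)]) \<in> fp_rel H K"
      using fp_rel.mult_right[of "[]" H K "[]" a b] by simp
    then show "fp_rel H K `` {[Inr (a \<otimes>\<^bsub>K\<^esub> b)]} =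
        fp_rel H K `` {[Inr a]} \<otimes>\<^bsub>free_product H K\<^esub> fp_rel H K `` {[Inr b]}"
      using ab free_product_mult_class[of "[Inr a]" H K "[Inr b]"]
        equiv_class_eq[OF equiv_fp_rel[of H K], of "[Inr a, Inr b]" "[Inr (a \<otimes>\<^bsub>K\<^esub> b)]"] by simp
  qed (auto intro!: free_product_class_closed)
qed

end

theory Submission
  imports Defs
begin

text \<open>Let \<open>g\<close> have the non-empty normal form \<open>w\<close>. Van der Waerden's action of \<open>H\<close> and \<open>K\<close> on
  reduced words can be cut down to the finitely many factor orbits met on the way from \<open>[]\<close> to
  \<open>w\<close>; then \<open>g\<close> still acts non-trivially, but only finitely many points are moved by both factors,
  so every commutator \<open>[h, k]\<close> has finite support and hence finite order. For \<open>a \<noteq> b\<close> in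
  \<open>H - {1}\<close> and \<open>c\<close> in \<open>K - {1}\<close>, suitable powers make \<open>x = [a, c]\<^sup>m [b, c]\<^sup>n\<close> act trivially. Cyclically
  \<open>x\<close> has no shorter period, so its centralizer is generated by \<open>x\<close>. Thus the normal closure of
  the centralizer acts trivially and misses \<open>g\<close>.\<close>

section \<open>Permutations and periodic words\<close>

text \<open>The commutator moves only points of \<open>B\<close> and of its images under \<sigma>
  and \<tau>. If \<tau> fixes a point outside these, the commutator does too, since one of the maps
  fixes its preimage under \<sigma>. If \<tau> moves it, \<sigma> fixes both the point and its
  preimage under \<tau>.\<close>

lemma permutation_commutator:
  assumes inverse: "\<sigma> \<circ> \<sigma>' = id" "\<sigma>' \<circ> \<sigma> = id" "\<tau> \<circ> \<tau>' = id" "\<tau>' \<circ> \<tau> = id"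
    and "finite B" and fixed: "\<And>x. x \<notin> B \<Longrightarrow> \<sigma> x = x \<or> \<tau> x = x"
  shows "permutation (\<sigma> \<circ> \<tau> \<circ> \<sigma>' \<circ> \<tau>')"
proof -
  have inv: "\<sigma> (\<sigma>' x) = x" "\<sigma>' (\<sigma> x) = x" "\<tau> (\<tau>' x) = x" "\<tau>' (\<tau> x) = x" for x
    using inverse by (simp_all add: fun_eq_iff)
  have "(\<sigma> \<circ> \<tau> \<circ> \<sigma>' \<circ> \<tau>') x = x" if x: "x \<notin> B \<union> \<tau> ` B \<union> \<sigma> ` B" for x
  proof (cases "\<tau>' x = x")
    case True
    have "\<sigma>' x \<notin> B" using x inv by (metis UnI2 imageI)
    then show ?thesis using True fixed[of "\<sigma>' x"] inv by (metis comp_apply)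
  next
    case False
    have "\<tau>' x \<notin> B" using x inv by (metis UnI1 UnI2 imageI)
    then have "\<sigma> (\<tau>' x) = \<tau>' x" using False fixed inv by metis
    moreover have "\<sigma> x = x" using False fixed[of x] x inv by (metis UnI1)
    ultimately show ?thesis using inv by (metis comp_apply)
  qed
  then have "{x. (\<sigma> \<circ> \<tau> \<circ> \<sigma>' \<circ> \<tau>') x \<noteq> x} \<subseteq> B \<union> \<tau> ` B \<union> \<sigma> ` B"
    by blast
  then have "finite {x. (\<sigma> \<circ> \<tau> \<circ> \<sigma>' \<circ> \<tau>') x \<noteq> x}"
    using \<open>finite B\<close> by (meson finite_UnI finite_imageI finite_subset)
  moreover have "bij \<sigma>" "bij \<sigma>'" "bij \<tau>" "bij \<tau>'"
    using inverse by (auto intro: o_bij)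
  ultimately show ?thesis
    unfolding permutation by (meson bij_comp)
qed

section \<open>Powers of words\<close>

definition word_power :: "nat \<Rightarrow> 'c list \<Rightarrow> 'c list" where
  "word_power n w = concat (replicate n w)"

lemma word_power_0 [simp]: "word_power 0 w = []"
  by (simp add: word_power_def)

lemma word_power_Suc [simp]: "word_power (Suc n) w = w @ word_power n w"
  by (simp add: word_power_def)

lemma length_word_power [simp]: "length (word_power n w) = n * length w"
  by (induction n) auto

lemma nth_word_power: "t < n * length w \<Longrightarrow> word_power n w ! t = w ! (t mod length w)"
proof (induction n arbitrary: t)
  case (Suc n)
  then show ?case
    by (cases "t < length w") (auto simp: nth_append le_mod_geq)
qed simp

lemma word_power_lists: "w \<in> lists A \<Longrightarrow> word_power n w \<in> lists A"
  by (induction n) auto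

lemma word_power_commute: "word_power n w @ w = w @ word_power n w"
  by (induction n) auto

lemma foldr_word_power: "foldr f (word_power n w) = foldr f w ^^ n"
  by (induction n) auto

text \<open>Cyclically, \<open>a'\<close> is followed by \<open>b\<close> two places later only where the two powers meet.\<close>

lemma aperiodic_product_of_powers:
  fixes w :: "('a + 'b) list"
  assumes "a \<noteq> b" "a' = b \<longleftrightarrow> b' = a" "a' \<noteq> b'" "0 < m" "0 < n"
    and w: "w = word_power m [Inl a, Inr c, Inl a', Inr c'] @ word_power n [Inl b, Inr c, Inl b', Inr c']"
    and shift: "\<And>t. w ! ((t + d) mod length w) = w ! (t mod length w)"
  shows "length w dvd d"
proof -
  \<comment> \<open>The block containing position \<open>r\<close>. Both powers are built from
    blocks of length four and the first has length \<open>4 * m\<close>, so \<open>r mod 4\<close>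
    indexes the letter in either case.\<close>
  define block where "block r = (if r < 4 * m then [Inl a, Inr c, Inl a', Inr c'] else [Inl b, Inr c, Inl b', Inr c'])" for r
  have len: "length w = 4 * m + 4 * n"
    by (simp add: w)
  have nth: "w ! r = block r ! (r mod 4)" if "r < length w" for r
  proof (cases "r < 4 * m")
    case True
    then show ?thesis by (simp add: w block_def nth_append nth_word_power)
  next
    case False
    then obtain s where "r = 4 * m + s" by (metis le_add_diff_inverse not_less)
    then show ?thesis using that len by (simp add: w block_def nth_append nth_word_power)
  qed
  \<comment> \<open>Position \<open>4 * m - 2\<close> carries the last \<open>a'\<close> of the
    first power, and two places later comes the first \<open>b\<close>. The shift takes the former
    position to \<open>r\<close>.\<close>
  define r where "r = (4 * m - 2 + d) mod length w"
  have r: "r < length w"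
    using len \<open>0 < m\<close> by (simp add: r_def)
  have "4 * m - 2 = 2 + (m - 1) * 4" using \<open>0 < m\<close> by simp
  then have "(4 * m - 2) mod 4 = 2" by (simp only: mod_mult_self1) simp
  then have r1: "w ! r = Inl a'"
    using shift[of "4 * m - 2"] nth[of "4 * m - 2"] len \<open>0 < m\<close> by (simp add: r_def block_def)
  have "(r + 2) mod length w = (4 * m - 2 + d + 2) mod length w"
    unfolding r_def by (rule mod_add_left_eq)
  also have "4 * m - 2 + d + 2 = 4 * m + d" using \<open>0 < m\<close> by simp
  finally have "(r + 2) mod length w = (4 * m + d) mod length w" .
  then have r2: "w ! ((r + 2) mod length w) = Inl b"
    using shift[of "4 * m"] nth[of "4 * m"] len \<open>0 < n\<close> by (simp add: block_def)
  have "r mod 4 \<noteq> 1" "r mod 4 \<noteq> 3"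
    using r1 nth[OF r] by (auto simp: block_def split: if_splits)
  moreover have "r mod 4 < 4" "r = 4 * (r div 4) + r mod 4" by simp_all
  ultimately have "r = 4 * (r div 4) \<or> r = 4 * (r div 4) + 2" by linarith
  then consider s where "r = 4 * s" | s where "r = 4 * s + 2" by blast
  then have "r = 4 * m - 2"
  proof cases
    \<comment> \<open>Here \<open>a'\<close> and \<open>b\<close> are both letters of one block. In
      the first power this gives \<open>a = a' = b\<close>; in the second,
      \<open>a' = b = b'\<close>, against \<open>a' \<noteq> b'\<close>.\<close>
    case (1 s)
    have "s < m + n" using 1 r len by linarith
    then have "r + 2 < length w" using 1 len by linarith
    moreover from this have "(r + 2) mod length w = r + 2" by (rule mod_less)
    moreover have "r + 2 < 4 * m \<longleftrightarrow> s < m" "r < 4 * m \<longleftrightarrow> s < m" using 1 by linarith+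
    moreover have "r + 2 = 2 + s * 4" using 1 by simp
    then have "(r + 2) mod 4 = 2" by (simp only: mod_mult_self1) simp
    moreover have "r mod 4 = 0" using 1 by simp
    ultimately show ?thesis
      using r1 r2 nth[OF r] nth[of "r + 2"] assms(1-3) by (auto simp: block_def split: if_splits)
  next
    \<comment> \<open>As \<open>a' \<noteq> b'\<close>, position \<open>r\<close> lies in the first
      power; as \<open>a \<noteq> b\<close>, the next block does not. So \<open>r\<close> lies in
      the last block of the first power.\<close>
    case (2 s)
    then have "r = 2 + s * 4" "r + 2 = (s + 1) * 4" by simp_all
    then have "r mod 4 = 2" "(r + 2) mod 4 = 0" by (simp_all only: mod_mult_self1 mod_mult_self2_is_0) simp
    then have "r < 4 * m"
      using r1 nth[OF r] assms(3) by (auto simp: block_def split: if_splits)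
    moreover from this have "r + 2 < length w" using 2 len \<open>0 < n\<close> by linarith
    then have "\<not> r + 2 < 4 * m"
      using r2 nth[of "r + 2"] \<open>(r + 2) mod 4 = 0\<close> assms(1) by (auto simp: block_def)
    ultimately have "m = s + 1" using 2 by linarith
    then show ?thesis using 2 by simp
  qed
  then have "(4 * m - 2 + d) mod length w = (4 * m - 2) mod length w"
    using r by (simp add: r_def)
  then show ?thesis
    by (simp add: mod_eq_dvd_iff_nat)
qed

section \<open>Reduced words\<close>

locale two_groups = H: group H + K: group K
  for H :: "('a, 'm) monoid_scheme" and K :: "('b, 'n) monoid_scheme"
begin

section \<open>Letters and the operations of their factors\<close>

abbreviation letters :: "('a + 'b) set" where
  "letters \<equiv> Sum_Type.Plus (carrier H) (carrier K)"

fun one_of :: "'a + 'b \<Rightarrow> 'a + 'b" where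
  "one_of (Inl a) = Inl \<one>\<^bsub>H\<^esub>"
| "one_of (Inr b) = Inr \<one>\<^bsub>K\<^esub>"

text \<open>The last clause is a default for letters of different factors, chosen so that the
  product always stays on the side of its first argument.\<close>

fun mult :: "'a + 'b \<Rightarrow> 'a + 'b \<Rightarrow> 'a + 'b" where
  "mult (Inl a) (Inl b) = Inl (a \<otimes>\<^bsub>H\<^esub> b)"
| "mult (Inr a) (Inr b) = Inr (a \<otimes>\<^bsub>K\<^esub> b)"
| "mult c d = c"

lemma one_of_letters [simp]: "one_of c \<in> letters"
  by (cases c) auto

lemma isl_one_of [simp]: "isl (one_of c) = isl c"
  by (cases c) auto

lemma one_of_cong: "isl c = isl d \<Longrightarrow> one_of c = one_of d"
  by (cases c; cases d) auto

lemma mult_letters [simp]: "c \<in> letters \<Longrightarrow> d \<in> letters \<Longrightarrow> mult c d \<in> letters"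
  by (cases c; cases d) auto

lemma isl_mult [simp]: "isl (mult c d) = isl c"
  by (cases c; cases d) auto

lemma mult_assoc:
  "c \<in> letters \<Longrightarrow> d \<in> letters \<Longrightarrow> e \<in> letters \<Longrightarrow> isl c = isl d \<Longrightarrow> isl d = isl e \<Longrightarrow>
    mult (mult c d) e = mult c (mult d e)"
  by (cases c; cases d; cases e) (auto simp: H.m_assoc K.m_assoc)

lemma mult_one_of [simp]: "c \<in> letters \<Longrightarrow> isl c = isl d \<Longrightarrow> mult c (one_of d) = c"
  by (cases c; cases d) auto

lemma one_of_mult [simp]: "c \<in> letters \<Longrightarrow> isl c = isl d \<Longrightarrow> mult (one_of d) c = c"
  by (cases c; cases d) auto

lemma fp_rel_one_of:
  assumes "u \<in> lists letters" "v \<in> lists letters"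
  shows "(u @ one_of c # v, u @ v) \<in> fp_rel H K"
  using assms fp_rel.one_left[of u H K v] fp_rel.one_right[of u H K v] by (cases c) auto

lemma fp_rel_mult:
  assumes "u \<in> lists letters" "v \<in> lists letters" "c \<in> letters" "d \<in> letters" "isl c = isl d"
  shows "(u @ c # d # v, u @ mult c d # v) \<in> fp_rel H K"
  using assms fp_rel.mult_left[of u H K v "projl c" "projl d"]
    fp_rel.mult_right[of u H K v "projr c" "projr d"] by (cases c; cases d) auto

definition reduced :: "('a + 'b) list set" where
  "reduced = {w \<in> lists letters.
    successively (\<lambda>c d. isl c \<noteq> isl d) w \<and> (\<forall>c\<in>set w. c \<noteq> one_of c)}"

lemma reduced_words: "w \<in> reduced \<Longrightarrow> w \<in> lists letters"
  by (simp add: reduced_def)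

lemma Nil_reduced [simp]: "[] \<in> reduced"
  by (simp add: reduced_def)

lemma Cons_reduced_iff:
  "c # w \<in> reduced \<longleftrightarrow> c \<in> letters \<and> c \<noteq> one_of c \<and> w \<in> reduced \<and> (w \<noteq> [] \<longrightarrow> isl (hd w) \<noteq> isl c)"
  by (auto simp: reduced_def successively_Cons)

lemma append_reduced_iff:
  "v @ w \<in> reduced \<longleftrightarrow> v \<in> reduced \<and> w \<in> reduced \<and>
    (v \<noteq> [] \<longrightarrow> w \<noteq> [] \<longrightarrow> isl (last v) \<noteq> isl (hd w))"
  by (auto simp: reduced_def successively_append_iff)

section \<open>The action of letters on reduced words\<close>

definition stem :: "'a + 'b \<Rightarrow> ('a + 'b) list \<Rightarrow> ('a + 'b) list" where
  "stem c w = (if w \<noteq> [] \<and> isl (hd w) = isl c then tl w else w)"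

text \<open>A word not beginning in the factor of \<open>c\<close> has identity component there;
  \<open>prepend\<close> undoes the splitting and drops such an identity. The reduced words with a
  common stem form one orbit of the factor under left multiplication.\<close>

definition head :: "'a + 'b \<Rightarrow> ('a + 'b) list \<Rightarrow> 'a + 'b" where
  "head c w = (if w \<noteq> [] \<and> isl (hd w) = isl c then hd w else one_of c)"

definition prepend :: "'a + 'b \<Rightarrow> ('a + 'b) list \<Rightarrow> ('a + 'b) list" where
  "prepend c w = (if c = one_of c then w else c # w)"

text \<open>For \<open>B = UNIV\<close> this is van der Waerden's left multiplication of reduced words. In general
  only the orbits of the two factors whose stem lies in \<open>B\<close> are kept, and all other points are
  fixed; the two factors still act.\<close>

definition act :: "('a + 'b) list set \<Rightarrow> 'a + 'b \<Rightarrow> ('a + 'b) list \<Rightarrow> ('a + 'b) list" where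
  "act B c w = (if w \<in> reduced \<and> stem c w \<in> B then prepend (mult c (head c w)) (stem c w) else w)"

lemma stem_cong: "isl c = isl d \<Longrightarrow> stem c w = stem d w"
  by (simp add: stem_def)

lemma head_cong: "isl c = isl d \<Longrightarrow> head c w = head d w"
  using one_of_cong[of c d] by (auto simp: head_def)

lemma stem_reduced: "w \<in> reduced \<Longrightarrow> stem c w \<in> reduced"
  by (cases w) (auto simp: stem_def Cons_reduced_iff)

lemma hd_stem: "w \<in> reduced \<Longrightarrow> stem c w \<noteq> [] \<Longrightarrow> isl (hd (stem c w)) \<noteq> isl c"
  by (cases w) (auto simp: stem_def Cons_reduced_iff split: if_splits)

lemma head_letters: "w \<in> reduced \<Longrightarrow> head c w \<in> letters"
  by (cases w) (auto simp: head_def Cons_reduced_iff)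

lemma isl_head: "isl (head c w) = isl c"
  by (auto simp: head_def)

lemma prepend_head_stem: "w \<in> reduced \<Longrightarrow> prepend (head c w) (stem c w) = w"
  by (cases w) (auto simp: head_def stem_def prepend_def Cons_reduced_iff one_of_cong[of "one_of c" c])

lemma prepend_reduced:
  "v \<in> reduced \<Longrightarrow> e \<in> letters \<Longrightarrow> (v \<noteq> [] \<Longrightarrow> isl (hd v) \<noteq> isl e) \<Longrightarrow> prepend e v \<in> reduced"
  by (auto simp: prepend_def Cons_reduced_iff)

lemma stem_prepend:
  "(v \<noteq> [] \<Longrightarrow> isl (hd v) \<noteq> isl e) \<Longrightarrow> isl c = isl e \<Longrightarrow> stem c (prepend e v) = v"
  by (auto simp: prepend_def stem_def)

lemma head_prepend:
  "(v \<noteq> [] \<Longrightarrow> isl (hd v) \<noteq> isl e) \<Longrightarrow> isl c = isl e \<Longrightarrow> head c (prepend e v) = e"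
  using one_of_cong[of c e] by (auto simp: prepend_def head_def)

lemma act_reduced:
  assumes "c \<in> letters" "w \<in> reduced"
  shows "act B c w \<in> reduced"
proof -
  have "prepend (mult c (head c w)) (stem c w) \<in> reduced"
    using assms hd_stem[of w c] by (intro prepend_reduced stem_reduced mult_letters head_letters) simp_all
  then show ?thesis using assms by (simp add: act_def)
qed

lemma act_one_of: "act B (one_of c) w = w"
  by (simp add: act_def head_letters isl_head prepend_head_stem[of w "one_of c"])

text \<open>Acting changes the head and keeps the stem, so membership of the stem in
  \<open>B\<close> is the same at both stages; the rest is associativity in the factor.\<close>

lemma act_mult:
  assumes "c \<in> letters" "d \<in> letters" "isl c = isl d"
  shows "act B c (act B d w) = act B (mult c d) w"
proof (cases "w \<in> reduced \<and> stem d w \<in> B")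
  case True
  define e v where "e = head d w" and "v = stem d w"
  have e: "e \<in> letters" "isl e = isl d" and v: "v \<in> reduced" "v \<noteq> [] \<Longrightarrow> isl (hd v) \<noteq> isl d" "v \<in> B"
    using True by (auto simp: e_def v_def head_letters isl_head stem_reduced hd_stem)
  have "act B d w = prepend (mult d e) v"
    using True by (simp add: act_def e_def v_def)
  moreover have "prepend (mult d e) v \<in> reduced"
    using e v assms by (intro prepend_reduced) auto
  moreover have "stem c (prepend (mult d e) v) = v" "head c (prepend (mult d e) v) = mult d e"
    using v assms by (auto intro!: stem_prepend head_prepend)
  moreover have "stem (mult c d) w = v" "head (mult c d) w = e"
    using stem_cong[of "mult c d" d] head_cong[of "mult c d" d] assms by (auto simp: e_def v_def)
  ultimately show ?thesis
    using v e True assms by (simp add: act_def mult_assoc)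
next
  case False
  then show ?thesis
    using stem_cong[of c d w] stem_cong[of "mult c d" d w] assms by (auto simp: act_def)
qed

section \<open>The action of words and normal forms\<close>

abbreviation act_word :: "('a + 'b) list set \<Rightarrow> ('a + 'b) list \<Rightarrow> ('a + 'b) list \<Rightarrow> ('a + 'b) list" where
  "act_word B \<equiv> foldr (act B)"

lemma act_word_reduced: "u \<in> lists letters \<Longrightarrow> w \<in> reduced \<Longrightarrow> act_word B u w \<in> reduced"
  by (induction u) (auto intro: act_reduced)

text \<open>Each defining relation involves a single factor, so every choice of \<open>B\<close>
  yields an action of the whole free product.\<close>

lemma act_word_rel: "(u, v) \<in> fp_rel H K \<Longrightarrow> act_word B u = act_word B v"
proof (induction rule: fp_rel.induct)
  case (one_left u v)
  then show ?case using act_one_of[of B "Inl \<one>\<^bsub>H\<^esub>"] by (auto simp: fun_eq_iff)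
next
  case (one_right u v)
  then show ?case using act_one_of[of B "Inr \<one>\<^bsub>K\<^esub>"] by (auto simp: fun_eq_iff)
next
  case (mult_left u v a b)
  then show ?case using act_mult[of "Inl a" "Inl b" B] by (auto simp: fun_eq_iff)
next
  case (mult_right u v a b)
  then show ?case using act_mult[of "Inr a" "Inr b" B] by (auto simp: fun_eq_iff)
qed auto

text \<open>As \<open>w\<close> is built up from its right end, each letter meets a suffix that does
  not begin in its factor. That suffix is its own stem, and its orbit is kept.\<close>

lemma act_word_Nil:
  assumes "w \<in> reduced" "\<And>i. drop i w \<in> B"
  shows "act_word B w [] = w"
  using assms
proof (induction w)
  case (Cons c w)
  have "drop i w \<in> B" for i using Cons.prems(2)[of "Suc i"] by simp
  moreover from this[of 0] have "w \<in> B" by simp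
  ultimately show ?case
    using Cons by (auto simp: act_def stem_def head_def prepend_def Cons_reduced_iff)
qed simp

text \<open>Equivalent words act alike, and with all orbits kept a reduced word sends the empty word
  to itself.\<close>

lemma reduced_unique: "(v, w) \<in> fp_rel H K \<Longrightarrow> v \<in> reduced \<Longrightarrow> w \<in> reduced \<Longrightarrow> v = w"
  using act_word_Nil[of v UNIV] act_word_Nil[of w UNIV] act_word_rel[of v w UNIV] by simp

lemma act_UNIV_rel:
  assumes "c \<in> letters" "w \<in> reduced"
  shows "(c # w, act UNIV c w) \<in> fp_rel H K"
proof -
  define e v where "e = head c w" and "v = stem c w"
  have e: "e \<in> letters" "isl e = isl c" and v: "v \<in> lists letters"
    using assms by (auto simp: e_def v_def head_letters isl_head intro!: reduced_words stem_reduced)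
  have prep: "(d # v, prepend d v) \<in> fp_rel H K" if "d \<in> letters" for d
    using that v fp_rel_one_of[of "[]" v d] fp_rel.refl[of "d # v" H K] by (auto simp: prepend_def)
  have "(e # v, w) \<in> fp_rel H K"
    using prep[OF e(1)] prepend_head_stem[OF assms(2)] by (simp add: e_def v_def)
  then have "(c # e # v, c # w) \<in> fp_rel H K"
    using fp_rel_context[of "e # v" w H K "[c]" "[]"] assms by simp
  moreover have "(c # e # v, mult c e # v) \<in> fp_rel H K"
    using fp_rel_mult[of "[]" v c e] assms e v by simp
  moreover have "(mult c e # v, act UNIV c w) \<in> fp_rel H K"
    using prep[of "mult c e"] assms e by (simp add: act_def e_def v_def)
  ultimately show ?thesis
    by (meson fp_rel.sym fp_rel.trans)
qed

text \<open>The unrestricted action computes normal forms of products; for empty \<open>w\<close> it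
  gives existence of the normal form of \<open>u\<close>.\<close>

lemma act_word_UNIV_rel:
  assumes "u \<in> lists letters" "w \<in> reduced"
  shows "(u @ w, act_word UNIV u w) \<in> fp_rel H K"
  using assms
proof (induction u)
  case Nil
  then show ?case by (simp add: fp_rel.refl reduced_words)
next
  case (Cons c u)
  then have "(c # u @ w, c # act_word UNIV u w) \<in> fp_rel H K"
    using fp_rel_context[of "u @ w" "act_word UNIV u w" H K "[c]" "[]"] by simp
  moreover have "(c # act_word UNIV u w, act_word UNIV (c # u) w) \<in> fp_rel H K"
    using Cons.hyps Cons.prems act_word_reduced[of u w UNIV] act_UNIV_rel[of c "act_word UNIV u w"]
    by auto
  ultimately show ?case using fp_rel.trans by auto
qed

text \<open>Each letter of \<open>u\<close> removes at most one letter at the front and adds at most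
  one, so the damage to \<open>v\<close> is bounded by \<open>length u\<close>.\<close>

lemma left_mult_reduced:
  assumes "u \<in> lists letters" "v \<in> reduced"
  obtains p j where "(u @ v, p @ drop j v) \<in> fp_rel H K" "p @ drop j v \<in> reduced"
    "length p \<le> length u" "j \<le> length u"
proof -
  have step: "\<exists>q i. act UNIV c w = q @ drop i w \<and> length q \<le> 1 \<and> i \<le> 1" if "w \<in> reduced" for c w
  proof -
    obtain i where "stem c w = drop i w" "i \<le> 1"
      using that[of 0] that[of 1]
      by (cases "w \<noteq> [] \<and> isl (hd w) = isl c") (auto simp: stem_def drop_Suc)
    moreover have "\<exists>q. prepend e v = q @ v \<and> length q \<le> 1" for e v
      by (auto simp: prepend_def intro: exI[of _ "[]"] exI[of _ "[e]"])
    ultimately show ?thesis using that by (simp add: act_def) metis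
  qed
  have "\<exists>p j. act_word UNIV u v = p @ drop j v \<and> length p \<le> length u \<and> j \<le> length u"
    using assms
  proof (induction u)
    case (Cons c u)
    then obtain p j where pj: "act_word UNIV u v = p @ drop j v" "length p \<le> length u" "j \<le> length u"
      by auto
    obtain q i where qi: "act UNIV c (p @ drop j v) = q @ drop i (p @ drop j v)" "length q \<le> 1" "i \<le> 1"
      using step[of "p @ drop j v" c] act_word_reduced[of u v UNIV] pj(1) Cons.hyps Cons.prems by auto
    show ?case
      \<comment> \<open>The \<open>i\<close> deleted letters come from \<open>p\<close> first;
        truncated subtraction leaves the excess, which is taken from \<open>v\<close>.\<close>
      using pj qi by (intro exI[of _ "q @ drop i p"] exI[of _ "i - length p + j"]) auto
  qed auto
  then show ?thesis
    using that act_word_UNIV_rel[OF assms] act_word_reduced[OF assms, of UNIV] by metis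
qed

text \<open>The action is a left action, so right multiplication is normalised directly, one letter
  at a time: the new letter vanishes, is appended, or merges with the last letter.\<close>

lemma right_mult_reduced:
  assumes "w \<in> lists letters" "v \<in> reduced"
  obtains p j where "(v @ w, take j v @ p) \<in> fp_rel H K" "take j v @ p \<in> reduced"
    "length p \<le> length w" "j \<le> length v" "length v \<le> j + length w"
proof -
  have step: "\<exists>p j. (v @ [c], take j v @ p) \<in> fp_rel H K \<and> take j v @ p \<in> reduced \<and>
      length p \<le> 1 \<and> j \<le> length v \<and> length v \<le> j + 1"
    if c: "c \<in> letters" and v: "v \<in> reduced" for c v
  proof -
    note vw = reduced_words[OF v]
    consider "c = one_of c" | "c \<noteq> one_of c" "v = []"
      | v' d where "c \<noteq> one_of c" "v = v' @ [d]" "isl d \<noteq> isl c"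
      | v' d where "c \<noteq> one_of c" "v = v' @ [d]" "isl d = isl c"
      by (cases v rule: rev_cases) auto
    then show ?thesis
    proof cases
      case 1
      then show ?thesis
        using v vw fp_rel_one_of[of v "[]" c] by (intro exI[of _ "[]"] exI[of _ "length v"]) simp
    next
      case 2
      then show ?thesis
        using c by (intro exI[of _ "[c]"] exI[of _ "0"]) (auto simp: Cons_reduced_iff intro: fp_rel.refl)
    next
      case (3 v' d)
      then show ?thesis
        using c v vw fp_rel.refl[of "v @ [c]" H K]
        by (intro exI[of _ "[c]"] exI[of _ "length v"])
          (auto simp: Cons_reduced_iff append_reduced_iff simp del: Plus_mem_iff)
    next
      case (4 v' d)
      then have rel: "(v @ [c], v' @ [mult d c]) \<in> fp_rel H K"
        using c vw fp_rel_mult[of v' "[]" d c] by simp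
      show ?thesis
      proof (cases "mult d c = one_of (mult d c)")
        case True
        then have "(v' @ [mult d c], v') \<in> fp_rel H K"
          using 4 vw fp_rel_one_of[of v' "[]" "mult d c"] by simp
        then have "(v @ [c], v') \<in> fp_rel H K"
          using rel by (rule fp_rel.trans[rotated])
        then show ?thesis
          using 4 v by (intro exI[of _ "[]"] exI[of _ "length v'"]) (auto simp: append_reduced_iff)
      next
        case False
        then show ?thesis
          using 4 v c rel by (intro exI[of _ "[mult d c]"] exI[of _ "length v'"])
            (auto simp: append_reduced_iff Cons_reduced_iff)
      qed
    qed
  qed
  have "\<exists>p j. (v @ w, take j v @ p) \<in> fp_rel H K \<and> take j v @ p \<in> reduced \<and>
      length p \<le> length w \<and> j \<le> length v \<and> length v \<le> j + length w"
    using assms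
  proof (induction w rule: rev_induct)
    case Nil
    then show ?case
      by (intro exI[of _ "[]"] exI[of _ "length v"]) (auto simp: fp_rel.refl reduced_words)
  next
    case (snoc c w)
    then obtain p j where pj: "(v @ w, take j v @ p) \<in> fp_rel H K" "take j v @ p \<in> reduced"
      "length p \<le> length w" "j \<le> length v" "length v \<le> j + length w"
      by auto
    obtain q i where qi: "((take j v @ p) @ [c], take i (take j v @ p) @ q) \<in> fp_rel H K"
      "take i (take j v @ p) @ q \<in> reduced" "length q \<le> 1" "j + length p \<le> i + 1"
      using step[OF _ pj(2), of c] snoc.prems pj(4) by (auto simp: min_absorb2)
    \<comment> \<open>For \<open>i \<le> j\<close> the cut removes all of \<open>p\<close> and may
      reach into \<open>v\<close>; otherwise \<open>i - j\<close> letters of \<open>p\<close>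
      survive.\<close>
    have eq: "take i (take j v @ p) @ q = take (min i j) v @ (take (i - j) p @ q)"
      using pj(4) by (simp add: min_absorb1 min_absorb2)
    have "((v @ w) @ [c], (take j v @ p) @ [c]) \<in> fp_rel H K"
      using snoc.prems by (intro fp_rel_append pj(1) fp_rel.refl) auto
    from fp_rel.trans[OF this qi(1)]
    have "(v @ w @ [c], take (min i j) v @ (take (i - j) p @ q)) \<in> fp_rel H K"
      unfolding eq by simp
    then show ?case
      using pj qi unfolding eq
      by (intro exI[of _ "take (i - j) p @ q"] exI[of _ "min i j"]) (auto simp: min_def)
  qed
  then show ?thesis using that by blast
qed

section \<open>Centralizers of aperiodic words\<close>

lemma word_power_reduced:
  assumes "w \<in> reduced" "w \<noteq> []" "isl (last w) \<noteq> isl (hd w)"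
  shows "word_power n w \<in> reduced"
proof (induction n)
  case (Suc n)
  have "hd (word_power n w) = hd w" if "word_power n w \<noteq> []"
    using that assms(2) by (cases n) auto
  then show ?case using Suc assms by (auto simp: append_reduced_iff)
qed simp

text \<open>Left multiplication by \<open>u\<close> changes only a prefix of a high power \<open>W\<close> of \<open>w\<close>, right
  multiplication only a suffix. Comparing \<open>u W\<close> with \<open>W u\<close> on the middle part exhibits a shift
  under which the periodic word is invariant.\<close>

lemma commutes_with_aperiodic:
  assumes w: "w \<noteq> []" "\<And>n. word_power n w \<in> reduced"
    and aperiodic: "\<And>d. (\<And>t. w ! ((t + d) mod length w) = w ! (t mod length w)) \<Longrightarrow> length w dvd d"
    and u: "u \<in> lists letters" "(u @ w, w @ u) \<in> fp_rel H K"
  obtains n m where "(u @ word_power n w, word_power m w) \<in> fp_rel H K"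
proof -
  define L where "L = length w"
  define l where "l = length u"
  \<comment> \<open>Multiplication by \<open>u\<close> disturbs at most \<open>l \<le> l * L\<close>
    letters of \<open>W\<close> at either end; this exponent leaves at least one full period
    untouched in between.\<close>
  define n where "n = 2 * l + 2"
  define W where "W = word_power n w"
  have ww: "w \<in> lists letters" and W: "W \<in> reduced"
    using w(2)[of 1] w(2)[of n] reduced_words by (simp_all add: W_def)
  have L: "L > 0" and lenW: "length W = n * L"
    using w(1) by (simp_all add: L_def W_def)
  have lL: "l \<le> l * L" using L by simp
  have nL: "n * L = l * L + l * L + 2 * L" by (simp add: n_def algebra_simps)
  have nthW: "W ! t = w ! (t mod L)" if "t < n * L" for t
    using that nth_word_power by (simp add: W_def L_def)
  have "(u @ word_power k w, word_power k w @ u) \<in> fp_rel H K" for k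
  proof (induction k)
    case 0
    then show ?case using u by (simp add: fp_rel.refl)
  next
    case (Suc k)
    have "((u @ w) @ word_power k w, (w @ u) @ word_power k w) \<in> fp_rel H K"
      using ww by (intro fp_rel_append u fp_rel.refl word_power_lists)
    moreover have "(w @ (u @ word_power k w), w @ (word_power k w @ u)) \<in> fp_rel H K"
      using ww by (intro fp_rel_append Suc fp_rel.refl)
    ultimately show ?case using fp_rel.trans by auto
  qed
  then have comm: "(u @ W, W @ u) \<in> fp_rel H K"
    by (simp add: W_def)
  obtain q i where qi: "(u @ W, q @ drop i W) \<in> fp_rel H K" "q @ drop i W \<in> reduced"
    "length q \<le> l" "i \<le> l"
    using left_mult_reduced[OF u(1) W] unfolding l_def by blast
  obtain p j where pj: "(W @ u, take j W @ p) \<in> fp_rel H K" "take j W @ p \<in> reduced"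
    "length p \<le> l" "j \<le> length W" "length W \<le> j + l"
    using right_mult_reduced[OF u(1) W] unfolding l_def by blast
  have eq: "q @ drop i W = take j W @ p"
    using qi pj comm by (meson reduced_unique fp_rel.sym fp_rel.trans)
  \<comment> \<open>The shift is \<open>i - length q\<close>, possibly negative; adding the multiple
    \<open>l * L\<close> of the period keeps it in the natural numbers.\<close>
  define d where "d = i + l * L - length q"
  have d: "d + length q = i + l * L" using qi(3) lL unfolding d_def by linarith
  have iW: "i \<le> length W"
    using qi(4) lenW nL lL by linarith
  \<comment> \<open>At these positions both normal forms show original letters of \<open>W\<close>,
    one of them displaced.\<close>
  have window: "w ! ((i + t - length q) mod L) = w ! (t mod L)" if "length q \<le> t" "t < l * L + L" for t
  proof -
    have t: "t < j" "t < n * L" "i + t - length q < n * L"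
      using that qi(4) pj(5) lenW nL lL L by linarith+
    have "(take j W @ p) ! t = W ! t"
      using t lenW by (simp add: nth_append)
    moreover have "(q @ drop i W) ! t = W ! (i + t - length q)"
      using that iW by (simp add: nth_append)
    ultimately show ?thesis
      using eq nthW t by simp
  qed
  have "L dvd d"
  proof (unfold L_def, rule aperiodic, fold L_def)
    fix t
    \<comment> \<open>The representative of \<open>t\<close> modulo \<open>L\<close> inside the
      window.\<close>
    define t' where "t' = t mod L + l * L"
    have "t' mod L = t mod L" by (simp add: t'_def)
    moreover have "length q \<le> t'" "t' < l * L + L" 
      unfolding t'_def using qi(3) lL mod_less_divisor[OF L, of t] by linarith+
    moreover have "(t + d) mod L = (t mod L + d) mod L" by (simp add: mod_simps)
    moreover have "t mod L + d = i + t' - length q"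
      using d by (simp add: t'_def)
    ultimately show "w ! ((t + d) mod L) = w ! (t mod L)"
      using window by metis
  qed
  have len: "length (q @ drop i W) + d = n * L + l * L"
    using d lenW iW by simp
  have "L dvd length (q @ drop i W)"
    using \<open>L dvd d\<close> len by (metis dvd_add_left_iff dvd_add dvd_triv_right)
  then obtain m where m: "length (q @ drop i W) = m * L"
    by (metis dvdE mult.commute)
  have "q @ drop i W = word_power m w"
  proof (rule nth_equalityI)
    show "length (q @ drop i W) = length (word_power m w)" using m by (simp add: L_def)
  next
    fix t assume t: "t < length (q @ drop i W)"
    have "(q @ drop i W) ! t = w ! (t mod L)"
    \<comment> \<open>Inside \<open>q\<close> the letter is read off the other normal form, which
      starts with \<open>take j W\<close>. Beyond \<open>q\<close> it comes from \<open>W\<close>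
      displaced by a multiple of the period.\<close>
    proof (cases "t < length q")
      case True
      then have "t < j" "t < n * L"
        using qi(3) pj(5) lenW nL lL L by linarith+
      then have "(take j W @ p) ! t = W ! t" "t < n * L"
        using lenW by (simp_all add: nth_append)
      then show ?thesis using eq nthW by simp
    next
      case False
      have "(i + t - length q) mod L = (i + t - length q + l * L) mod L" by simp
      also have "i + t - length q + l * L = t + d" using False d by simp
      also have "(t + d) mod L = t mod L" using \<open>L dvd d\<close> by (simp add: mod_add_eq[symmetric])
      finally show ?thesis
        using False t nthW[of "i + t - length q"] qi lenW nL lL by (simp add: nth_append)
    qed
    then show "(q @ drop i W) ! t = word_power m w ! t"
      using t m nth_word_power[of t m w] by (simp add: L_def)
  qed
  then show ?thesis using that[of n m] qi(1) by (simp add: W_def)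
qed

section \<open>Kernels of the restricted actions\<close>

fun inv_of :: "'a + 'b \<Rightarrow> 'a + 'b" where
  "inv_of (Inl a) = Inl (inv\<^bsub>H\<^esub> a)"
| "inv_of (Inr b) = Inr (inv\<^bsub>K\<^esub> b)"

lemma inv_of_letters [simp]: "c \<in> letters \<Longrightarrow> inv_of c \<in> letters"
  by (cases c) auto

lemma isl_inv_of [simp]: "isl (inv_of c) = isl c"
  by (cases c) auto

lemma act_inv_of:
  assumes "c \<in> letters"
  shows "act B c \<circ> act B (inv_of c) = id" "act B (inv_of c) \<circ> act B c = id"
proof -
  have "mult c (inv_of c) = one_of c" "mult (inv_of c) c = one_of c"
    using assms by (cases c; auto)+
  then show "act B c \<circ> act B (inv_of c) = id" "act B (inv_of c) \<circ> act B c = id"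
    using assms by (simp_all add: fun_eq_iff act_mult act_one_of)
qed

text \<open>Finiteness of \<open>B\<close> bounds the set of points moved by both factors.\<close>

lemma act_commutator_power:
  assumes "c \<in> letters" "d \<in> letters" "isl c \<noteq> isl d" "finite B"
  obtains n where "0 < n" "act_word B (word_power n [c, d, inv_of c, inv_of d]) = id"
proof -
  have "act B c x = x \<or> act B d x = x" if "x \<notin> B" for x
  proof -
    \<comment> \<open>A word begins in at most one factor, so it is its own stem for the other;
      outside \<open>B\<close>, the letter of that other factor fixes it.\<close>
    have "stem c x = x \<or> stem d x = x" using assms(3) by (auto simp: stem_def)
    then show ?thesis using that by (auto simp: act_def)
  qed
  then have "permutation (act B c \<circ> act B d \<circ> act B (inv_of c) \<circ> act B (inv_of d))"
    using assms by (intro permutation_commutator act_inv_of) auto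
  then obtain n where "0 < n" "(act B c \<circ> act B d \<circ> act B (inv_of c) \<circ> act B (inv_of d)) ^^ n = id"
    using permutation_is_nilpotent by blast
  then show ?thesis
    using that[of n] by (simp add: foldr_word_power comp_assoc)
qed

section \<open>The kernel as a normal subgroup\<close>

definition act_kernel :: "('a + 'b) list set \<Rightarrow> ('a + 'b) list set set" where
  "act_kernel B = {A \<in> carrier (free_product H K). \<forall>u\<in>A. act_word B u = id}"

lemma class_in_act_kernel_iff:
  assumes "u \<in> lists letters"
  shows "fp_rel H K `` {u} \<in> act_kernel B \<longleftrightarrow> act_word B u = id"
  using assms act_word_rel[of u _ B]
  by (auto simp: act_kernel_def free_product_class_closed intro: fp_rel.refl)

text \<open>The usual argument for kernels, carried out on representing words instead of through a
  homomorphism into a permutation group.\<close>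

lemma act_kernel_normal: "act_kernel B \<lhd> free_product H K"
proof -
  let ?G = "free_product H K"
  interpret G: group ?G
    by (rule free_product_group) (rule H.is_group K.is_group)+
  have one: "\<one>\<^bsub>?G\<^esub> = fp_rel H K `` {[]}"
    by (simp add: free_product_def)
  have kernelE: "\<exists>u. u \<in> lists letters \<and> A = fp_rel H K `` {u} \<and> act_word B u = id"
    if "A \<in> act_kernel B" for A
  proof -
    have "A \<in> carrier ?G" using that by (simp add: act_kernel_def)
    then show ?thesis using that class_in_act_kernel_iff by (metis free_product_carrierE)
  qed
  \<comment> \<open>A word for the inverse class acts as a right inverse of \<open>u\<close>, which
    suffices both for inverses and for conjugates.\<close>
  have inverse: "\<exists>v. v \<in> lists letters \<and> inv\<^bsub>?G\<^esub> (fp_rel H K `` {u}) = fp_rel H K `` {v} \<and>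
      act_word B u \<circ> act_word B v = id" if u: "u \<in> lists letters" for u
  proof -
    have "inv\<^bsub>?G\<^esub> (fp_rel H K `` {u}) \<in> carrier ?G"
      using free_product_class_closed[OF u] by simp
    then obtain v where v: "v \<in> lists letters" "inv\<^bsub>?G\<^esub> (fp_rel H K `` {u}) = fp_rel H K `` {v}"
      by (rule free_product_carrierE)
    have "fp_rel H K `` {u @ v} = fp_rel H K `` {[]}"
      using G.r_inv[OF free_product_class_closed[OF u]] free_product_mult_class[OF u v(1)] v(2)
      by (simp add: one)
    then have "(u @ v, []) \<in> fp_rel H K"
      using u v(1) by (simp add: eq_equiv_class_iff[OF equiv_fp_rel])
    then have "act_word B (u @ v) = id" using act_word_rel[of "u @ v" "[]" B] by simp
    then show ?thesis using v by (auto simp: fun_eq_iff)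
  qed
  have subgroup: "subgroup (act_kernel B) ?G"
  proof (rule G.subgroupI)
    show "act_kernel B \<subseteq> carrier ?G" by (auto simp: act_kernel_def)
    show "act_kernel B \<noteq> {}"
      using class_in_act_kernel_iff[of "[]" B] by auto
  next
    fix x assume "x \<in> act_kernel B"
    then obtain u where "u \<in> lists letters" "x = fp_rel H K `` {u}" "act_word B u = id"
      using kernelE by blast
    moreover from this obtain v where "v \<in> lists letters" "inv\<^bsub>?G\<^esub> x = fp_rel H K `` {v}"
      "act_word B u \<circ> act_word B v = id"
      using inverse by metis
    ultimately show "inv\<^bsub>?G\<^esub> x \<in> act_kernel B"
      using class_in_act_kernel_iff by simp
  next
    fix x y assume "x \<in> act_kernel B" "y \<in> act_kernel B"
    then obtain u v where "u \<in> lists letters" "x = fp_rel H K `` {u}" "act_word B u = id"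
      "v \<in> lists letters" "y = fp_rel H K `` {v}" "act_word B v = id"
      using kernelE by metis
    then show "x \<otimes>\<^bsub>?G\<^esub> y \<in> act_kernel B"
      using class_in_act_kernel_iff[of "u @ v" B] by (simp add: free_product_mult_class fun_eq_iff)
  qed
  show ?thesis
  proof (rule G.normal_invI[OF subgroup])
    fix x y assume x: "x \<in> carrier ?G" and "y \<in> act_kernel B"
    then obtain v where v: "v \<in> lists letters" "y = fp_rel H K `` {v}" "act_word B v = id"
      using kernelE by metis
    obtain u where u: "u \<in> lists letters" "x = fp_rel H K `` {u}"
      using x by (rule free_product_carrierE)
    obtain u' where u': "u' \<in> lists letters" "inv\<^bsub>?G\<^esub> x = fp_rel H K `` {u'}"
      "act_word B u \<circ> act_word B u' = id"
      using inverse u by metis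
    have uv: "u @ v \<in> lists letters" "(u @ v) @ u' \<in> lists letters" using u v u' by auto
    have "x \<otimes>\<^bsub>?G\<^esub> y \<otimes>\<^bsub>?G\<^esub> inv\<^bsub>?G\<^esub> x = fp_rel H K `` {(u @ v) @ u'}"
      unfolding u'(2) unfolding u(2) v(2)
      by (simp only: free_product_mult_class u(1) v(1) u'(1) uv)
    moreover have "act_word B ((u @ v) @ u') = id"
      using v(3) u'(3) by (simp add: fun_eq_iff)
    ultimately show "x \<otimes>\<^bsub>?G\<^esub> y \<otimes>\<^bsub>?G\<^esub> inv\<^bsub>?G\<^esub> x \<in> act_kernel B"
      using class_in_act_kernel_iff[OF uv(2)] by simp
  qed
qed

text \<open>The element depends on \<open>B\<close> through the exponents that make both commutators
  act trivially. The distinct elements \<open>a\<close> and \<open>b\<close> keep their product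
  cyclically aperiodic.\<close>

lemma centralizer_in_act_kernel:
  assumes H: "a \<in> carrier H" "b \<in> carrier H" "a \<noteq> \<one>\<^bsub>H\<^esub>" "b \<noteq> \<one>\<^bsub>H\<^esub>" "a \<noteq> b"
    and K: "c \<in> carrier K" "c \<noteq> \<one>\<^bsub>K\<^esub>" and "finite B"
  obtains x where "x \<in> carrier (free_product H K)"
    "centralizer (free_product H K) x \<subseteq> act_kernel B"
proof -
  define s where "s h = [Inl h, Inr c, Inl (inv\<^bsub>H\<^esub> h), Inr (inv\<^bsub>K\<^esub> c)]" for h
  have s: "\<exists>n>0. act_word B (word_power n (s h)) = id" if "h \<in> carrier H" for h
    using act_commutator_power[of "Inl h" "Inr c" B] that K \<open>finite B\<close> unfolding s_def by auto
  obtain m n where m: "0 < m" "act_word B (word_power m (s a)) = id"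
    and n: "0 < n" "act_word B (word_power n (s b)) = id"
    using s[OF H(1)] s[OF H(2)] by blast
  define w where "w = word_power m (s a) @ word_power n (s b)"
  have w_id: "act_word B w = id"
    using m n by (simp add: w_def fun_eq_iff)
  have "s h \<in> reduced" if "h \<in> carrier H" "h \<noteq> \<one>\<^bsub>H\<^esub>" for h
    using that K by (auto simp: s_def Cons_reduced_iff H.inv_eq_1_iff K.inv_eq_1_iff)
  moreover have "isl (last (s h)) \<noteq> isl (hd (s h))" "s h \<noteq> []" for h
    by (simp_all add: s_def)
  ultimately have sp: "word_power k (s h) \<in> reduced" if "h \<in> carrier H" "h \<noteq> \<one>\<^bsub>H\<^esub>" for h k
    using that word_power_reduced by blast
  \<comment> \<open>A positive power begins in \<open>H\<close> and ends in \<open>K\<close>, so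
    neither the seam inside \<open>w\<close> nor those between copies of \<open>w\<close> allow
    cancellation.\<close>
  have hd_sp: "isl (hd (word_power k (s h)))" if "0 < k" for h k
    using that by (cases k) (auto simp: s_def)
  have last_sp: "\<not> isl (last (word_power k (s h)))" if "0 < k" for h k
  proof -
    obtain l where "k = Suc l" using \<open>0 < k\<close> by (cases k) auto
    then have "word_power k (s h) = word_power l (s h) @ s h" by (simp add: word_power_commute)
    then show ?thesis by (simp add: s_def)
  qed
  have ne_sp: "word_power k (s h) \<noteq> []" if "0 < k" for h k
    using that by (cases k) (auto simp: s_def)
  have "w \<in> reduced" "w \<noteq> []" "isl (last w) \<noteq> isl (hd w)"
    using sp hd_sp last_sp ne_sp m n H by (auto simp: w_def append_reduced_iff)
  then have wp: "word_power k w \<in> reduced" for k by (rule word_power_reduced)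
  have ww: "w \<in> lists letters" using \<open>w \<in> reduced\<close> by (rule reduced_words)
  have aperiodic: "length w dvd d" if "\<And>t. w ! ((t + d) mod length w) = w ! (t mod length w)" for d
  proof (rule aperiodic_product_of_powers[OF _ _ _ m(1) n(1) _ that])
    show "w = word_power m [Inl a, Inr c, Inl (inv\<^bsub>H\<^esub> a), Inr (inv\<^bsub>K\<^esub> c)] @
        word_power n [Inl b, Inr c, Inl (inv\<^bsub>H\<^esub> b), Inr (inv\<^bsub>K\<^esub> c)]"
      by (simp add: w_def s_def)
    show "inv\<^bsub>H\<^esub> a = b \<longleftrightarrow> inv\<^bsub>H\<^esub> b = a" using H by auto
    show "inv\<^bsub>H\<^esub> a \<noteq> inv\<^bsub>H\<^esub> b" using H by (metis H.inv_inv)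
  qed (use H in simp)
  show ?thesis
  proof (rule that[of "fp_rel H K `` {w}"])
    show "fp_rel H K `` {w} \<in> carrier (free_product H K)"
      using ww by (rule free_product_class_closed)
    show "centralizer (free_product H K) (fp_rel H K `` {w}) \<subseteq> act_kernel B"
    proof
      fix y assume y: "y \<in> centralizer (free_product H K) (fp_rel H K `` {w})"
      then obtain u where u: "u \<in> lists letters" "y = fp_rel H K `` {u}"
        unfolding centralizer_def using free_product_carrierE by blast
      have "fp_rel H K `` {u @ w} = fp_rel H K `` {w @ u}"
        using y u ww by (simp add: centralizer_def free_product_mult_class)
      then have "(u @ w, w @ u) \<in> fp_rel H K"
        using u ww by (simp add: eq_equiv_class_iff[OF equiv_fp_rel])
      then obtain k l where "(u @ word_power k w, word_power l w) \<in> fp_rel H K"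
        using commutes_with_aperiodic[OF \<open>w \<noteq> []\<close> wp aperiodic u(1)] by metis
      \<comment> \<open>Nonnegative powers on both sides express that \<open>u\<close> represents a
        power of \<open>w\<close>, possibly with negative exponent. Since \<open>w\<close> acts
        trivially, so does \<open>u\<close>.\<close>
      then have "act_word B u \<circ> act_word B (word_power k w) = act_word B (word_power l w)"
        using act_word_rel[of "u @ word_power k w" _ B] by (simp add: fun_eq_iff)
      then show "y \<in> act_kernel B"
        using class_in_act_kernel_iff[OF u(1)] u(2) w_id by (simp add: foldr_word_power)
    qed
  qed
qed

end

section \<open>The pseudocentre of the free product\<close>

theorem theorem6p9:
  fixes H :: "('a, 'm) monoid_scheme" and K :: "('b, 'n) monoid_scheme"
  assumes "group H" and "group K"
    and "carrier H \<noteq> {\<one>\<^bsub>H\<^esub>}" and "carrier K \<noteq> {\<one>\<^bsub>K\<^esub>}"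
    and "infinite (carrier H) \<or> card (carrier H) > 2"
  shows "pseudocentre (free_product H K) = {\<one>\<^bsub>free_product H K\<^esub>}"
proof
  let ?G = "free_product H K"
  interpret two_groups H K
    using assms(1,2) by (simp add: two_groups_def)
  interpret G: group ?G
    using assms(1,2) by (rule free_product_group)
  obtain a where a: "a \<in> carrier H" "a \<noteq> \<one>\<^bsub>H\<^esub>"
    using assms(3) H.one_closed by blast
  obtain c where c: "c \<in> carrier K" "c \<noteq> \<one>\<^bsub>K\<^esub>"
    using assms(4) K.one_closed by blast
  have "\<not> carrier H \<subseteq> {\<one>\<^bsub>H\<^esub>, a}"
  proof
    assume sub: "carrier H \<subseteq> {\<one>\<^bsub>H\<^esub>, a}"
    then have "finite (carrier H)" by (rule finite_subset) simp
    moreover have "card (carrier H) \<le> card {\<one>\<^bsub>H\<^esub>, a}" using sub by (intro card_mono) auto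
    moreover have "card {\<one>\<^bsub>H\<^esub>, a} \<le> 2" using card_insert_le_m1[of 2 "{a}"] by simp
    ultimately show False using assms(5) by linarith
  qed
  then obtain b where b: "b \<in> carrier H" "b \<noteq> \<one>\<^bsub>H\<^esub>" "a \<noteq> b"
    by blast
  show "pseudocentre ?G \<subseteq> {\<one>\<^bsub>?G\<^esub>}"
  proof
    fix g assume g: "g \<in> pseudocentre ?G"
    \<comment> \<open>The term of the intersection at the identity already places \<open>g\<close>
      in the group.\<close>
    have "normal_closure ?G (centralizer ?G \<one>\<^bsub>?G\<^esub>) \<subseteq> carrier ?G"
      using normal_imp_subgroup[OF G.normal_self] G.normal_self
      by (auto simp: normal_closure_def centralizer_def)
    then have "g \<in> carrier ?G" using g by (auto simp: pseudocentre_def)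
    then obtain u where u: "u \<in> lists letters" "g = fp_rel H K `` {u}"
      by (rule free_product_carrierE)
    define w where "w = act_word UNIV u []"
    have w: "w \<in> reduced" "(u, w) \<in> fp_rel H K"
      using act_word_reduced[OF u(1), of "[]"] act_word_UNIV_rel[OF u(1), of "[]"]
      by (simp_all add: w_def)
    have gw: "g = fp_rel H K `` {w}"
      using u(2) equiv_class_eq[OF equiv_fp_rel w(2)] by simp
    \<comment> \<open>The suffixes of \<open>w\<close> include every stem met in building
      \<open>w\<close> from the empty word. They are finitely many, since dropping beyond the length
      always gives the empty word.\<close>
    define B where "B = range (\<lambda>i. drop i w)"
    have "drop i w \<in> insert [] ((\<lambda>i. drop i w) ` {..length w})" for i
      by (cases "i \<le> length w") auto
    then have "B \<subseteq> insert [] ((\<lambda>i. drop i w) ` {..length w})"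
      by (auto simp: B_def)
    then have "finite B" by (rule finite_subset) simp
    then obtain x where x: "x \<in> carrier ?G" "centralizer ?G x \<subseteq> act_kernel B"
      using centralizer_in_act_kernel[of a b c B] a b c by metis
    have "normal_closure ?G (centralizer ?G x) \<subseteq> act_kernel B"
      using x(2) act_kernel_normal by (auto simp: normal_closure_def)
    then have "g \<in> act_kernel B"
      using g x(1) by (auto simp: pseudocentre_def)
    then have "act_word B w = id"
      using gw class_in_act_kernel_iff reduced_words[OF w(1)] by simp
    \<comment> \<open>With this \<open>B\<close>, the word \<open>w\<close> still sends the empty
      word to \<open>w\<close>, while a trivial action fixes the empty word.\<close>
    then have "w = []"
      using act_word_Nil[OF w(1), of B] by (simp add: B_def)
    then show "g \<in> {\<one>\<^bsub>?G\<^esub>}"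
      using gw by (simp add: free_product_def)
  qed
  show "{\<one>\<^bsub>?G\<^esub>} \<subseteq> pseudocentre ?G"
    by (auto simp: pseudocentre_def normal_closure_def dest: normal_imp_subgroup intro: subgroup.one_closed)
qed

end
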